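(* Let $\sigma(x)=\max\{x,0\}$ be the ReLU function, applied entrywise to matrices. For any $Z=Z_{\mathcal M}+Z_{\mathcal M^\perp}\in\mathbb{R}^{d\times n}$, let $H=\sigma(Z)=H_{\mathcal M}+H_{\mathcal M^\perp}$. Then $H_{\mathcal M^\perp}$ lies on the sphere (with respect to the Frobenius norm) centered at $Z_{\mathcal M^\perp}/2$ with radius $$r:=\Big(\|Z_{\mathcal M^\perp}/2\|_F^2-\langle H_{\mathcal M},H_{\mathcal M}-Z_{\mathcal M}\rangle_F\Big)^{1/2}$$ (in particular the quantity under the root is nonnegative). In particular, $H_{\mathcal M^\perp}$ lies inside the closed ball centered at $Z_{\mathcal M^\perp}/2$ with radius $\|Z_{\mathcal M^\perp}/2\|_F$, and hence $\|H\|_{\mathcal M^\perp}\le\|Z\|_{\mathcal M^\perp}$.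
   Context: Let $G=(V,E)$ be an undirected graph with $n$ nodes, adjacency matrix $A\in\{0,1\}^{n\times n}$ and diagonal degree matrix $D$, $D_{ii}=\sum_j A_{ij}$. Put $\tilde A=A+I$, $\tilde D=D+I$, and let $\mathbf G=\tilde D^{-1/2}\tilde A\tilde D^{-1/2}$. Let $\mathcal M\subseteq\mathbb{R}^n$ be the eigenspace of $\mathbf G$ for its largest eigenvalue $1$, of dimension $m$ equal to the number of connected components of the graph; if $u_i\in\{0,1\}^n$ is the indicator vector of the $i$-th connected component, the entrywise nonnegative vectors $e_i=\tilde D^{1/2}u_i/\|\tilde D^{1/2}u_i\|$, $1\le i\le m$, form an orthonormal basis of $\mathcal M$. Extend to an orthonormal eigenbasis $e_1,\dots,e_n$ of $\mathbb{R}^n$ for $\mathbf G$. For $H\in\mathbb{R}^{d\times n}$ write $H_{\mathcal M}=\sum_{i=1}^m He_ie_i^\top$ and $H_{\mathcal M^\perp}=\sum_{i=m+1}^n He_ie_i^\top$, so $H=H_{\mathcal M}+H_{\mathcal M^\perp}$. $\langle A,B\rangle_F=\mathrm{Trace}(AB^\top)$ is the Frobenius inner product, $\|\cdot\|_F$ the Frobenius norm, and $\|H\|_{\mathcal M^\perp}:=\|H_{\mathcal M^\perp}\|_F$ (the distance of $H$ to $\mathbb{R}^d\otimes\mathcal M$, the space of matrices all of whose rows lie in $\mathcal M$). *)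

theory Defs
  imports "HOL-Analysis.Analysis"
begin

text \<open>
  An undirected graph on the node type \<open>'n\<close> (so \<open>n = CARD('n)\<close>) is given by a symmetric adjacency
  relation \<open>E\<close>. Self-loops are neither required nor excluded. The connected components are the
  classes \<open>UNIV // E\<^sup>*\<close>; an isolated node is a component.
\<close>

definition adj_mat :: "('n \<times> 'n) set \<Rightarrow> real^'n^'n" where
  "adj_mat E = (\<chi> i j. if (i, j) \<in> E then 1 else 0)"

definition deg_mat :: "('n \<times> 'n) set \<Rightarrow> real^'n^'n" where
  "deg_mat E = (\<chi> i j. if i = j then \<Sum>k\<in>UNIV. adj_mat E $ i $ k else 0)"

definition adj_tilde :: "('n \<times> 'n) set \<Rightarrow> real^'n^'n" where
  "adj_tilde E = adj_mat E + mat 1"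

definition deg_tilde :: "('n \<times> 'n) set \<Rightarrow> real^'n^'n" where
  "deg_tilde E = deg_mat E + mat 1"

text \<open>Real powers of a diagonal matrix with positive diagonal; off-diagonal entries are ignored.\<close>

definition diag_powr :: "real^'n^'n \<Rightarrow> real \<Rightarrow> real^'n^'n" where
  "diag_powr B p = (\<chi> i j. if i = j then B $ i $ i powr p else 0)"

definition prop_mat :: "('n::finite \<times> 'n) set \<Rightarrow> real^'n^'n" where
  "prop_mat E = diag_powr (deg_tilde E) (-1/2) ** adj_tilde E ** diag_powr (deg_tilde E) (-1/2)"

definition eigenspace :: "real^'n^'n \<Rightarrow> real \<Rightarrow> (real^'n) set" where
  "eigenspace B l = {v. B *v v = l *\<^sub>R v}"

definition indicator_vec :: "'n set \<Rightarrow> real^'n" where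
  "indicator_vec S = (\<chi> i. if i \<in> S then 1 else 0)"

definition component_vec :: "('n::finite \<times> 'n) set \<Rightarrow> 'n set \<Rightarrow> real^'n" where
  "component_vec E S =
     (let w = diag_powr (deg_tilde E) (1/2) *v indicator_vec S in (1 / norm w) *\<^sub>R w)"

definition outer :: "real^'d \<Rightarrow> real^'n \<Rightarrow> real^'n^'d" where
  "outer x y = (\<chi> i j. x $ i * y $ j)"

definition mat_M :: "(nat \<Rightarrow> real^'n) \<Rightarrow> nat \<Rightarrow> real^'n^'d \<Rightarrow> real^'n^'d" where
  "mat_M e m H = (\<Sum>i = 1..m. outer (H *v e i) (e i))"

definition mat_Mperp :: "(nat \<Rightarrow> real^'n) \<Rightarrow> nat \<Rightarrow> real^'n^'d \<Rightarrow> real^'n^'d" where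
  "mat_Mperp e m H = (\<Sum>i = m + 1..CARD('n). outer (H *v e i) (e i))"

definition frob_inner :: "real^'n^'d \<Rightarrow> real^'n^'d \<Rightarrow> real" where
  "frob_inner A B = trace (A ** transpose B)"

definition norm_Mperp :: "(nat \<Rightarrow> real^'n) \<Rightarrow> nat \<Rightarrow> real^'n^'d \<Rightarrow> real" where
  "norm_Mperp e m H = norm (mat_Mperp e m H)"

definition relu :: "real \<Rightarrow> real" where
  "relu x = max x 0"

text \<open>
  The library's inner product and norm on \<open>real^'n^'d\<close> are the Frobenius ones, so \<open>norm\<close>, \<open>sphere\<close>
  and \<open>cball\<close> on matrices refer to the Frobenius norm.
\<close>

lemma frob_inner_eq_inner: "frob_inner A B = inner A B"
  by (simp add: frob_inner_def trace_def matrix_matrix_mult_def transpose_def inner_vec_def)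

lemma norm_eq_frobenius: "norm A = sqrt (frob_inner A A)" for A :: "real^'n^'d"
  by (simp add: frob_inner_eq_inner norm_eq_sqrt_inner)

text \<open>
  The eigenvalue \<open>1\<close> is the largest eigenvalue of \<open>prop_mat E\<close>, and the dimension of its eigenspace
  is the number of connected components. For the proofs, \<open>nb\<close> and \<open>dg\<close> name the entries of
  \<open>adj_tilde E\<close> and the diagonal entries of \<open>deg_tilde E\<close>.
\<close>

definition nb :: "('n::finite \<times> 'n) set \<Rightarrow> 'n \<Rightarrow> 'n \<Rightarrow> real" where
  "nb E i j = adj_tilde E $ i $ j"

definition dg :: "('n::finite \<times> 'n) set \<Rightarrow> 'n \<Rightarrow> real" where
  "dg E i = (\<Sum>j\<in>UNIV. nb E i j)"

lemma nb_nonneg: "0 \<le> nb E i j"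
  by (simp add: nb_def adj_tilde_def adj_mat_def mat_def)

lemma nb_sym: "sym E \<Longrightarrow> nb E i j = nb E j i"
  by (auto simp: nb_def adj_tilde_def adj_mat_def mat_def dest: symD)

lemma dg_pos: "0 < dg E i"
proof -
  have "0 < nb E i i" by (simp add: nb_def adj_tilde_def adj_mat_def mat_def)
  also have "\<dots> \<le> dg E i" unfolding dg_def by (rule member_le_sum) (auto simp: nb_nonneg)
  finally show ?thesis .
qed

lemma deg_tilde_nth: "deg_tilde E $ i $ i = dg E i"
  by (simp add: deg_tilde_def deg_mat_def dg_def nb_def adj_tilde_def mat_def sum.distrib)

lemma diag_powr_mult_nth: "(diag_powr (deg_tilde E) p *v v) $ i = dg E i powr p * v $ i"
  by (simp add: diag_powr_def deg_tilde_nth matrix_vector_mult_def if_distrib[of "\<lambda>x. x * _"]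
      cong: if_cong)

lemma eigen_iff:
  fixes v :: "real^'n" and E :: "('n \<times> 'n) set"
  shows "prop_mat E *v v = l *\<^sub>R v \<longleftrightarrow>
    (\<forall>i. (\<Sum>j\<in>UNIV. nb E i j * (v $ j / sqrt (dg E j))) = l * dg E i * (v $ i / sqrt (dg E i)))"
proof -
  have p: "dg E i powr (-1/2) = 1 / sqrt (dg E i)" for i
  proof -
    have "dg E i powr (-1/2) = dg E i powr (-(1/2))" by (simp only: minus_divide_left)
    also have "\<dots> = 1 / dg E i powr (1/2)" by (rule powr_minus_divide)
    also have "\<dots> = 1 / sqrt (dg E i)" by (simp only: powr_half_sqrt[OF less_imp_le[OF dg_pos]])
    finally show ?thesis .
  qed
  have "(prop_mat E *v v) $ i =
      1 / sqrt (dg E i) * (\<Sum>j\<in>UNIV. nb E i j * (v $ j / sqrt (dg E j)))" for i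
  proof -
    have "prop_mat E *v v = diag_powr (deg_tilde E) (-1/2) *v
        (adj_tilde E *v (diag_powr (deg_tilde E) (-1/2) *v v))"
      unfolding prop_mat_def by (simp only: matrix_vector_mul_assoc matrix_mul_assoc)
    then show ?thesis
      by (simp only: diag_powr_mult_nth p matrix_vector_mult_def[of "adj_tilde E"] vec_lambda_beta)
         (simp add: nb_def)
  qed
  moreover have "1 / sqrt (dg E i) * S = l * v $ i \<longleftrightarrow> S = l * dg E i * (v $ i / sqrt (dg E i))" for i S
  proof -
    have "dg E i = sqrt (dg E i) * sqrt (dg E i)" and s: "sqrt (dg E i) > 0"
      using dg_pos[of E i] by simp_all
    moreover have "1 / s * S = l * x \<longleftrightarrow> S = l * (s * s) * (x / s)" if "s > 0" for s x :: real
      using that by (simp add: field_simps)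
    ultimately show ?thesis by (metis s)
  qed
  ultimately show ?thesis by (simp add: vec_eq_iff)
qed

lemma eigenvalue_le_1:
  assumes "prop_mat E *v v = l *\<^sub>R v" "v \<noteq> 0"
  shows "l \<le> 1"
proof -
  define w where "w j = v $ j / sqrt (dg E j)" for j
  have eq: "(\<Sum>j\<in>UNIV. nb E i j * w j) = l * dg E i * w i" for i
    using assms(1) unfolding eigen_iff w_def by blast
  have "Max (range (\<lambda>j. \<bar>w j\<bar>)) \<in> range (\<lambda>j. \<bar>w j\<bar>)" by (intro Max_in) auto
  then obtain i where i: "\<bar>w i\<bar> = Max (range (\<lambda>j. \<bar>w j\<bar>))" by (metis imageE)
  have max: "\<bar>w j\<bar> \<le> \<bar>w i\<bar>" for j unfolding i by (intro Max_ge) auto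
  obtain k where "v $ k \<noteq> 0" using assms(2) by (auto simp: vec_eq_iff)
  then have "w k \<noteq> 0" using dg_pos[of E k] by (simp add: w_def)
  then have wi: "0 < \<bar>w i\<bar>" using max[of k] by linarith
  have "\<bar>l\<bar> * (dg E i * \<bar>w i\<bar>) = \<bar>\<Sum>j\<in>UNIV. nb E i j * w j\<bar>"
    using dg_pos[of E i] by (simp add: eq abs_mult)
  also have "\<dots> \<le> (\<Sum>j\<in>UNIV. \<bar>nb E i j * w j\<bar>)" by (rule sum_abs)
  also have "\<dots> \<le> (\<Sum>j\<in>UNIV. nb E i j * \<bar>w i\<bar>)"
    by (intro sum_mono) (simp add: abs_mult nb_nonneg max mult_left_mono)
  also have "\<dots> = 1 * (dg E i * \<bar>w i\<bar>)" by (simp add: dg_def sum_distrib_right)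
  finally have "\<bar>l\<bar> \<le> 1" using wi dg_pos[of E i] mult_le_cancel_right_pos zero_less_mult_iff by metis
  then show ?thesis by simp
qed

lemma eigenspace_1_iff:
  fixes v :: "real^'n" and E :: "('n \<times> 'n) set"
  assumes "sym E"
  shows "v \<in> eigenspace (prop_mat E) 1 \<longleftrightarrow>
    (\<forall>i j. (i, j) \<in> E \<longrightarrow> v $ i / sqrt (dg E i) = v $ j / sqrt (dg E j))" (is "?L \<longleftrightarrow> ?R")
proof -
  define w where "w j = v $ j / sqrt (dg E j)" for j
  have L: "?L \<longleftrightarrow> (\<forall>i. (\<Sum>j\<in>UNIV. nb E i j * w j) = dg E i * w i)"
    by (simp add: eigenspace_def eigen_iff w_def del: scaleR_one)
  show ?thesis
  proof
    assume ?L
    then have eq: "(\<Sum>j\<in>UNIV. nb E i j * w j) = dg E i * w i" for i using L by blast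
    have a: "(\<Sum>i\<in>UNIV. \<Sum>j\<in>UNIV. nb E i j * (w i * w j)) = (\<Sum>i\<in>UNIV. dg E i * (w i)\<^sup>2)"
    proof (rule sum.cong[OF refl])
      fix i
      have "(\<Sum>j\<in>UNIV. nb E i j * (w i * w j)) = w i * (\<Sum>j\<in>UNIV. nb E i j * w j)"
        by (simp add: sum_distrib_left mult.left_commute)
      then show "(\<Sum>j\<in>UNIV. nb E i j * (w i * w j)) = dg E i * (w i)\<^sup>2"
        by (simp add: eq power2_eq_square)
    qed
    have b: "(\<Sum>i\<in>UNIV. \<Sum>j\<in>UNIV. nb E i j * (w i)\<^sup>2) = (\<Sum>i\<in>UNIV. dg E i * (w i)\<^sup>2)"
      by (simp add: dg_def sum_distrib_right)
    have c: "(\<Sum>i\<in>UNIV. \<Sum>j\<in>UNIV. nb E i j * (w j)\<^sup>2) = (\<Sum>i\<in>UNIV. dg E i * (w i)\<^sup>2)"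
      by (subst sum.swap) (simp add: dg_def sum_distrib_right nb_sym[OF assms])
    have "(\<Sum>i\<in>UNIV. \<Sum>j\<in>UNIV. nb E i j * (w i - w j)\<^sup>2) =
      (\<Sum>i\<in>UNIV. \<Sum>j\<in>UNIV. nb E i j * (w i)\<^sup>2) + (\<Sum>i\<in>UNIV. \<Sum>j\<in>UNIV. nb E i j * (w j)\<^sup>2)
        - 2 * (\<Sum>i\<in>UNIV. \<Sum>j\<in>UNIV. nb E i j * (w i * w j))"
      by (simp add: sum_distrib_left sum.distrib[symmetric] sum_subtractf[symmetric]
          power2_diff algebra_simps)
    then have "(\<Sum>i\<in>UNIV. \<Sum>j\<in>UNIV. nb E i j * (w i - w j)\<^sup>2) = 0" by (simp add: a b c)
    then have z: "nb E i j * (w i - w j)\<^sup>2 = 0" for i j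
      by (simp add: sum_nonneg_eq_0_iff sum_nonneg nb_nonneg)
    show ?R
    proof (intro allI impI)
      fix i j assume "(i, j) \<in> E"
      then have "nb E i j \<noteq> 0" by (simp add: nb_def adj_tilde_def adj_mat_def mat_def)
      with z[of i j] show "v $ i / sqrt (dg E i) = v $ j / sqrt (dg E j)" by (simp add: w_def)
    qed
  next
    assume R: ?R
    have "nb E i j * w j = nb E i j * w i" for i j
    proof (cases "(i, j) \<in> E")
      case True with R show ?thesis by (simp add: w_def)
    next
      case False then show ?thesis by (simp add: nb_def adj_tilde_def adj_mat_def mat_def)
    qed
    then show ?L unfolding L dg_def sum_distrib_right by (simp only: simp_thms)
  qed
qed

lemma equiv_rtrancl: "sym E \<Longrightarrow> equiv UNIV (E\<^sup>*)"
  by (simp add: equiv_def refl_rtrancl sym_rtrancl trans_rtrancl)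

lemma span_component_vecs:
  fixes E :: "('n::finite \<times> 'n) set"
  assumes "sym E"
  shows "span (component_vec E ` (UNIV // E\<^sup>*)) = eigenspace (prop_mat E) 1"
    and "dim (eigenspace (prop_mat E) 1) = card (UNIV // E\<^sup>*)"
proof -
  note eqv = equiv_rtrancl[OF assms]
  define f where "f S = diag_powr (deg_tilde E) (1/2) *v indicator_vec S" for S :: "'n set"
  have f_nth: "f S $ i = (if i \<in> S then sqrt (dg E i) else 0)" for S i
    using dg_pos[of E i] by (simp add: f_def diag_powr_mult_nth indicator_vec_def powr_half_sqrt)
  have dg_ne: "dg E i \<noteq> 0" for i using dg_pos[of E i] by simp
  have f_ne: "f S \<noteq> 0" if S: "S \<in> UNIV // E\<^sup>*" for S
  proof -
    obtain i where "i \<in> S" using in_quotient_imp_non_empty[OF eqv S] by blast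
    then have "f S $ i \<noteq> 0" using dg_pos[of E i] by (simp add: f_nth)
    then show ?thesis by auto
  qed
  have cv: "component_vec E S = (1 / norm (f S)) *\<^sub>R f S" for S
    by (simp add: component_vec_def f_def Let_def)
  have cv_ne: "component_vec E S \<noteq> 0" if "S \<in> UNIV // E\<^sup>*" for S
    using f_ne[OF that] by (simp add: cv)
  have cv_orth: "inner (component_vec E S) (component_vec E T) = 0"
    if "S \<in> UNIV // E\<^sup>*" "T \<in> UNIV // E\<^sup>*" "S \<noteq> T" for S T
  proof -
    have "S \<inter> T = {}" using quotient_disj[OF eqv that(1,2)] that(3) by blast
    then have "inner (f S) (f T) = 0"
      by (auto simp: inner_vec_def f_nth intro!: sum.neutral)
    then show ?thesis by (simp add: cv)
  qed
  let ?B = "component_vec E ` (UNIV // E\<^sup>*)"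
  have sub: "?B \<subseteq> eigenspace (prop_mat E) 1"
  proof clarify
    fix S assume S: "S \<in> UNIV // E\<^sup>*"
    have "i \<in> S \<longleftrightarrow> j \<in> S" if "(i, j) \<in> E" for i j
      using S that assms by (auto elim!: quotientE intro: rtrancl_into_rtrancl dest: symD)
    then show "component_vec E S \<in> eigenspace (prop_mat E) 1"
      unfolding eigenspace_1_iff[OF assms] cv by (auto simp: f_nth dg_ne)
  qed
  have subsp: "subspace (eigenspace (prop_mat E) 1)"
    by (auto simp: subspace_def eigenspace_def matrix_vector_right_distrib matrix_vector_mult_scaleR)
  have sup: "eigenspace (prop_mat E) 1 \<subseteq> span ?B"
  proof
    fix v assume "v \<in> eigenspace (prop_mat E) 1"
    then have v: "v $ i / sqrt (dg E i) = v $ j / sqrt (dg E j)" if "(i, j) \<in> E" for i j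
      using that unfolding eigenspace_1_iff[OF assms] by blast
    have vv: "v $ i / sqrt (dg E i) = v $ j / sqrt (dg E j)" if "(i, j) \<in> E\<^sup>*" for i j
      using that by induction (auto dest: v)
    define c where "c S = v $ (SOME i. i \<in> S) / sqrt (dg E (SOME i. i \<in> S))" for S :: "'n set"
    have c: "c S = v $ i / sqrt (dg E i)" if S: "S \<in> UNIV // E\<^sup>*" "i \<in> S" for S i
    proof -
      have "(SOME i. i \<in> S) \<in> S" using S(2) by (rule someI)
      then have "((SOME i. i \<in> S), i) \<in> E\<^sup>*" using quotient_eq_iff[OF eqv S(1) S(1)] S(2) by blast
      then show ?thesis unfolding c_def by (rule vv)
    qed
    have "v = (\<Sum>S\<in>UNIV // E\<^sup>*. c S *\<^sub>R f S)"
    proof (subst vec_eq_iff, intro allI)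
      fix i
      let ?S = "E\<^sup>* `` {i}"
      have S: "?S \<in> UNIV // E\<^sup>*" by (simp add: quotientI)
      have "(c T *\<^sub>R f T) $ i = (if T = ?S then v $ i else 0)" if T: "T \<in> UNIV // E\<^sup>*" for T
      proof (cases "i \<in> T")
        case True
        have "T = ?S" using quotient_disj[OF eqv T S] True by auto
        moreover have "c T * sqrt (dg E i) = v $ i" unfolding c[OF T True] using dg_ne[of i] by simp
        ultimately show ?thesis using True by (simp add: f_nth)
      next
        case False
        then have "T \<noteq> ?S" by auto
        with False show ?thesis by (simp add: f_nth)
      qed
      then have "(\<Sum>S\<in>UNIV // E\<^sup>*. c S *\<^sub>R f S) $ i = (\<Sum>T\<in>UNIV // E\<^sup>*. if T = ?S then v $ i else 0)"
        unfolding sum_component by (rule sum.cong[OF refl])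
      then show "v $ i = (\<Sum>S\<in>UNIV // E\<^sup>*. c S *\<^sub>R f S) $ i" using S by simp
    qed
    moreover have "f S = norm (f S) *\<^sub>R component_vec E S" for S by (simp add: cv)
    ultimately have "v = (\<Sum>S\<in>UNIV // E\<^sup>*. c S *\<^sub>R (norm (f S) *\<^sub>R component_vec E S))" by simp
    also have "\<dots> \<in> span ?B" by (intro span_sum span_scale span_base imageI)
    finally show "v \<in> span ?B" .
  qed
  have inj: "inj_on (component_vec E) (UNIV // E\<^sup>*)"
  proof (rule inj_onI, rule ccontr)
    fix S T assume S: "S \<in> UNIV // E\<^sup>*" "T \<in> UNIV // E\<^sup>*" "component_vec E S = component_vec E T" "S \<noteq> T"
    then have "inner (component_vec E S) (component_vec E S) = 0"
      using cv_orth[OF S(1,2,4)] by simp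
    then show False using cv_ne[OF S(1)] by simp
  qed
  have "pairwise orthogonal ?B"
    using cv_orth by (intro pairwise_imageI) (auto simp: orthogonal_def)
  then have ind: "independent ?B"
  proof (rule pairwise_orthogonal_independent)
    show "0 \<notin> ?B" by (metis cv_ne imageE)
  qed
  show *: "span ?B = eigenspace (prop_mat E) 1"
    using span_minimal[OF sub subsp] sup by blast
  show "dim (eigenspace (prop_mat E) 1) = card (UNIV // E\<^sup>*)"
    using dim_eq_card[OF _ ind, of "eigenspace (prop_mat E) 1"] * card_image[OF inj]
    by (metis span_span)
qed

lemma one_is_largest_eigenvalue:
  fixes E :: "('n::finite \<times> 'n) set"
  assumes "sym E"
  shows "\<exists>v. v \<noteq> 0 \<and> prop_mat E *v v = 1 *\<^sub>R v"
    and "\<And>l v. v \<noteq> 0 \<Longrightarrow> prop_mat E *v v = l *\<^sub>R v \<Longrightarrow> l \<le> 1"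
proof -
  have "UNIV // E\<^sup>* \<noteq> {}" by (auto simp: quotient_def)
  then have "dim (eigenspace (prop_mat E) 1) \<noteq> 0"
    using span_component_vecs(2)[OF assms] by (simp add: finite_quotient)
  then have "\<not> eigenspace (prop_mat E) 1 \<subseteq> {0}" by (simp add: dim_eq_0)
  then show "\<exists>v. v \<noteq> 0 \<and> prop_mat E *v v = 1 *\<^sub>R v" by (auto simp: eigenspace_def)
qed (rule eigenvalue_le_1)

end

theory Submission
  imports Defs
begin

text \<open>
  Entrywise, \<open>\<sigma>(z) (\<sigma>(z) - z) = 0\<close>, so \<open>\<langle>H, H - Z\<rangle> = 0\<close>. Both parts of the decomposition are
  orthogonal, hence \<open>\<langle>H\<^sub>\<perp>, H\<^sub>\<perp> - Z\<^sub>\<perp>\<rangle> = - \<langle>H\<^sub>M, H\<^sub>M - Z\<^sub>M\<rangle>\<close>, and completing the square gives the sphere.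
  As \<open>H\<close>, \<open>H - Z\<close> and the \<open>e\<^sub>i\<close> with \<open>i \<le> m\<close> are entrywise nonnegative,
  \<open>\<langle>H\<^sub>M, H\<^sub>M - Z\<^sub>M\<rangle> = \<Sum>\<^sub>i\<^sub>\<le>\<^sub>m (H e\<^sub>i) \<bullet> ((H - Z) e\<^sub>i) \<ge> 0\<close>, which gives the ball.
\<close>

lemma outer_mult_vec: "outer x y *v z = (y \<bullet> z) *\<^sub>R x"
  by (simp add: vec_eq_iff outer_def matrix_vector_mult_def inner_vec_def sum_distrib_left
      mult_ac)

text \<open>Turns a Frobenius product with a rank-one matrix into an inner product of vectors, so
  that all later products can be computed one index \<open>i\<close> at a time.\<close>

lemma inner_outer: "outer x y \<bullet> B = x \<bullet> (B *v y)"
  by (simp add: outer_def matrix_vector_mult_def inner_vec_def sum_distrib_left mult_ac)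

lemma sum_matrix_vector_mult: "(\<Sum>i\<in>S. F i) *v v = (\<Sum>i\<in>S. F i *v v)"
  for F :: "'i \<Rightarrow> real^'n^'d"
  by (induction S rule: infinite_finite_induct) (simp_all add: matrix_vector_mult_add_rdistrib)

lemma inner_sum_outer:
  fixes A B :: "real^'n^'d"
  shows "(\<Sum>i\<in>S. outer (A *v e i) (e i)) \<bullet> B = (\<Sum>i\<in>S. (A *v e i) \<bullet> (B *v e i))"
  by (simp add: inner_sum_left inner_outer)

text \<open>By orthonormality the right-hand sum maps each \<open>e j\<close> with
  \<open>j \<in> S\<close> to \<open>B *v e j\<close>, so against the left-hand sum it cannot be
  told apart from \<open>B\<close>.\<close>

lemma inner_sum_outer_sum_outer:
  fixes A B :: "real^'n^'d" and e :: "'i \<Rightarrow> real^'n"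
  assumes "finite S" and on: "\<And>i j. i \<in> S \<Longrightarrow> j \<in> S \<Longrightarrow> e i \<bullet> e j = (if i = j then 1 else 0)"
  shows "(\<Sum>i\<in>S. outer (A *v e i) (e i)) \<bullet> (\<Sum>i\<in>S. outer (B *v e i) (e i)) =
    (\<Sum>i\<in>S. (A *v e i) \<bullet> (B *v e i))"
proof -
  have "(\<Sum>i\<in>S. outer (B *v e i) (e i)) *v e j = B *v e j" if "j \<in> S" for j
  proof -
    have "(\<Sum>i\<in>S. outer (B *v e i) (e i)) *v e j = (\<Sum>i\<in>S. if i = j then B *v e i else 0)"
      unfolding sum_matrix_vector_mult
      by (rule sum.cong) (simp_all add: outer_mult_vec on that)
    then show ?thesis using assms(1) that by simp
  qed
  then show ?thesis unfolding inner_sum_outer by simp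
qed

text \<open>Two equal members with different indices would have inner product both 0 and 1, so
  \<open>e\<close> is injective on \<open>S\<close>. Its image is then an independent set of full
  cardinality, hence an orthonormal basis.\<close>

lemma orthonormal_family_expand:
  fixes e :: "'i \<Rightarrow> real^'n"
  assumes "finite S" "card S = CARD('n)"
    and on: "\<And>i j. i \<in> S \<Longrightarrow> j \<in> S \<Longrightarrow> e i \<bullet> e j = (if i = j then 1 else 0)"
  shows "(\<Sum>i\<in>S. (v \<bullet> e i) *\<^sub>R e i) = v"
proof -
  have inj: "inj_on e S"
    using on by (metis inj_onI zero_neq_one)
  have orth: "pairwise orthogonal (e ` S)"
    using on by (auto simp: pairwise_def orthogonal_def)
  have "0 \<notin> e ` S"
    using on by force
  then have ind: "independent (e ` S)"
    using orth by (rule pairwise_orthogonal_independent[rotated])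
  have "UNIV \<subseteq> span (e ` S)"
    by (rule card_ge_dim_independent) (use ind assms(2) in \<open>simp_all add: card_image[OF inj]\<close>)
  then have "(\<Sum>b\<in>e ` S. (v \<bullet> b) *\<^sub>R b) = v"
    by (intro orthonormal_basis_expand orth) (use on assms(1) in \<open>auto simp: norm_eq_1\<close>)
  then show ?thesis
    by (simp add: sum.reindex[OF inj])
qed

text \<open>Row \<open>k\<close> of the sum is the expansion of row \<open>k\<close> of
  \<open>A\<close> in the basis.\<close>

lemma sum_outer_orthonormal:
  fixes A :: "real^'n^'d" and e :: "'i \<Rightarrow> real^'n"
  assumes "finite S" "card S = CARD('n)"
    and "\<And>i j. i \<in> S \<Longrightarrow> j \<in> S \<Longrightarrow> e i \<bullet> e j = (if i = j then 1 else 0)"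
  shows "(\<Sum>i\<in>S. outer (A *v e i) (e i)) = A"
proof (subst vec_eq_iff, intro allI)
  fix k
  have "outer (A *v e i) (e i) $ k = (A $ k \<bullet> e i) *\<^sub>R e i" for i
    by (simp add: vec_eq_iff outer_def matrix_vector_mult_def inner_vec_def)
  then show "(\<Sum>i\<in>S. outer (A *v e i) (e i)) $ k = A $ k"
    using orthonormal_family_expand[OF assms, of "A $ k"] by simp
qed

lemma component_vec_nonneg: "0 \<le> component_vec E S $ i"
  by (simp add: component_vec_def Let_def diag_powr_mult_nth indicator_vec_def)

lemma inner_mult_vec_nonneg:
  fixes A B :: "real^'n^'d"
  assumes "\<And>i j. 0 \<le> A $ i $ j" "\<And>i j. 0 \<le> B $ i $ j" "\<And>j. 0 \<le> v $ j"
  shows "0 \<le> (A *v v) \<bullet> (B *v v)"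
  using assms by (simp add: inner_vec_def matrix_vector_mult_def sum_nonneg)

theorem proposition3p2:
  fixes E :: "('n::finite \<times> 'n) set"
    and m :: nat
    and C :: "nat \<Rightarrow> 'n set"
    and e :: "nat \<Rightarrow> real^'n"
    and Z H :: "real^'n^'d"
    and r :: real
  assumes graph: "sym E"
    and m_dim: "m = dim (eigenspace (prop_mat E) 1)"
    and components: "bij_betw C {1..m} (UNIV // E\<^sup>*)"
    and e_components: "\<forall>i\<in>{1..m}. e i = component_vec E (C i)"
    and e_orthonormal: "\<forall>i\<in>{1..CARD('n)}. \<forall>j\<in>{1..CARD('n)}. e i \<bullet> e j = (if i = j then 1 else 0)"
    and e_eigen: "\<forall>i\<in>{1..CARD('n)}. \<exists>l. e i \<in> eigenspace (prop_mat E) l"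
    and H_def: "H = map_matrix relu Z"
    and r_def: "r = sqrt ((norm ((1/2) *\<^sub>R mat_Mperp e m Z))\<^sup>2
                          - frob_inner (mat_M e m H) (mat_M e m H - mat_M e m Z))"
  shows "0 \<le> (norm ((1/2) *\<^sub>R mat_Mperp e m Z))\<^sup>2
               - frob_inner (mat_M e m H) (mat_M e m H - mat_M e m Z)
      \<and> mat_Mperp e m H \<in> sphere ((1/2) *\<^sub>R mat_Mperp e m Z) r
      \<and> mat_Mperp e m H \<in> cball ((1/2) *\<^sub>R mat_Mperp e m Z) (norm ((1/2) *\<^sub>R mat_Mperp e m Z))
      \<and> norm_Mperp e m H \<le> norm_Mperp e m Z"
proof -
  let ?hM = "mat_M e m H" and ?hP = "mat_Mperp e m H"
  let ?zM = "mat_M e m Z" and ?zP = "mat_Mperp e m Z"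
  \<comment> \<open>This bound makes the index ranges of \<open>mat_M\<close> and
    \<open>mat_Mperp\<close> a partition of the whole basis.\<close>
  have "m \<le> CARD('n)"
    using dim_subset_UNIV[of "eigenspace (prop_mat E) 1"] m_dim by simp
  then have split: "{1..CARD('n)} = {1..m} \<union> {m + 1..CARD('n)}"
    and subs: "{1..m} \<subseteq> {1..CARD('n)}" "{m + 1..CARD('n)} \<subseteq> {1..CARD('n)}"
    by auto
  have on: "e i \<bullet> e j = (if i = j then 1 else 0)"
    if "i \<in> {1..CARD('n)}" "j \<in> {1..CARD('n)}" for i j
    using e_orthonormal that by blast
  have gM: "mat_M e m A \<bullet> mat_M e m B = (\<Sum>i = 1..m. (A *v e i) \<bullet> (B *v e i))"
    for A B :: "real^'n^'d"
    unfolding mat_M_def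
    by (rule inner_sum_outer_sum_outer) (use on subs(1) in blast)+
  have gP: "mat_Mperp e m A \<bullet> mat_Mperp e m B = (\<Sum>i = m + 1..CARD('n). (A *v e i) \<bullet> (B *v e i))"
    for A B :: "real^'n^'d"
    unfolding mat_Mperp_def
    by (rule inner_sum_outer_sum_outer) (use on subs(2) in blast)+
  \<comment> \<open>Parseval over the full basis, cut at \<open>m\<close>; no mixed terms between
    the two parts occur.\<close>
  have parts: "A \<bullet> B = mat_M e m A \<bullet> mat_M e m B + mat_Mperp e m A \<bullet> mat_Mperp e m B"
    for A B :: "real^'n^'d"
  proof -
    have "A \<bullet> B = (\<Sum>i = 1..CARD('n). outer (A *v e i) (e i)) \<bullet> B"
      using sum_outer_orthonormal[of "{1..CARD('n)}" e A] on by simp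
    also have "\<dots> = (\<Sum>i = 1..CARD('n). (A *v e i) \<bullet> (B *v e i))"
      by (rule inner_sum_outer)
    also have "\<dots> = mat_M e m A \<bullet> mat_M e m B + mat_Mperp e m A \<bullet> mat_Mperp e m B"
      unfolding gM gP split by (rule sum.union_disjoint) auto
    finally show ?thesis .
  qed
  have "H \<bullet> H = H \<bullet> Z"
    unfolding inner_vec_def
    by (intro sum.cong refl) (simp add: H_def map_matrix_def relu_def max_def)
  then have "?hM \<bullet> (?hM - ?zM) + ?hP \<bullet> (?hP - ?zP) = 0"
    using parts[of H H] parts[of H Z] by (simp add: inner_diff_right)
  \<comment> \<open>Since the center is half of \<open>?zP\<close>, the cross term is exactly
    \<open>- (?zP \<bullet> ?hP)\<close>.\<close>
  moreover have "(norm ((1/2) *\<^sub>R ?zP - ?hP))\<^sup>2 = (norm ((1/2) *\<^sub>R ?zP))\<^sup>2 + ?hP \<bullet> (?hP - ?zP)"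
    by (simp add: power2_norm_eq_inner inner_diff_left inner_diff_right inner_commute
        del: norm_scaleR)
  ultimately have dist: "(norm ((1/2) *\<^sub>R ?zP - ?hP))\<^sup>2 =
      (norm ((1/2) *\<^sub>R ?zP))\<^sup>2 - frob_inner ?hM (?hM - ?zM)"
    by (simp only: frob_inner_eq_inner)
  \<comment> \<open>The entries of \<open>H - Z\<close> are max(-z, 0) for the entries z of
    \<open>Z\<close>.\<close>
  have "0 \<le> (H *v e i) \<bullet> ((H - Z) *v e i)" if "i \<in> {1..m}" for i
    by (rule inner_mult_vec_nonneg)
      (use that e_components in \<open>auto simp: H_def map_matrix_def relu_def component_vec_nonneg\<close>)
  then have "0 \<le> ?hM \<bullet> mat_M e m (H - Z)"
    unfolding gM by (rule sum_nonneg)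
  then have M_nonneg: "0 \<le> frob_inner ?hM (?hM - ?zM)"
    by (simp add: frob_inner_eq_inner inner_diff_right gM matrix_vector_mult_diff_rdistrib
        sum_subtractf)
  \<comment> \<open>By \<open>dist\<close> the radicand is a squared distance: it is nonnegative,
    and its root \<open>r\<close> is the distance from the center to \<open>?hP\<close>.\<close>
  have "0 \<le> (norm ((1/2) *\<^sub>R ?zP))\<^sup>2 - frob_inner ?hM (?hM - ?zM)"
    unfolding dist[symmetric] by simp
  moreover have "?hP \<in> sphere ((1/2) *\<^sub>R ?zP) r"
    unfolding mem_sphere dist_norm r_def dist[symmetric] by simp
  moreover have ball: "norm ((1/2) *\<^sub>R ?zP - ?hP) \<le> norm ((1/2) *\<^sub>R ?zP)"
    by (rule power2_le_imp_le) (use dist M_nonneg in linarith, simp)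
  \<comment> \<open>The origin lies on the boundary of the ball, so no point of the ball is farther
    from it than the diameter \<open>norm ?zP\<close>.\<close>
  moreover have "norm ?hP \<le> norm ?zP"
  proof -
    have "norm ?hP \<le> norm ((1/2) *\<^sub>R ?zP) + norm ((1/2) *\<^sub>R ?zP - ?hP)"
      by (metis norm_triangle_sub norm_minus_commute)
    also have "\<dots> \<le> norm ?zP"
      using ball by simp
    finally show ?thesis .
  qed
  ultimately show ?thesis
    by (simp add: dist_norm norm_Mperp_def)
qed

end
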